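(* Let $\mathbf{v}_1,\dots,\mathbf{v}_n$ be linearly independent elements of $c_0(\mathbb{N})$ and $\mathcal{V}:=\mathrm{span}\{\mathbf{v}_1,\dots,\mathbf{v}_n\}$. Then: (A1) for every nonzero $\mathbf{v}\in\mathcal{V}$, the set $\mathbb{N}(\mathbf{v})$ is finite and $$\mathrm{ext}\bigl(\partial\|\cdot\|_\infty(\mathbf{v})\bigr)\subset\{-K(\cdot,j),K(\cdot,j):j\in\mathbb{N}(\mathbf{v})\};$$ (A2) for every $m\in\mathbb{N}$, all distinct $l_1,\dots,l_m\in\mathbb{N}$ and every $\boldsymbol{\alpha}=[\alpha_1,\dots,\alpha_m]\in\mathbb{R}^m$, $$\Bigl\|\sum_{j=1}^m\alpha_jK(\cdot,l_j)\Bigr\|_1=\|\boldsymbol{\alpha}\|_1 .$$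
   Context: $\ell_1(\mathbb{N})$ (absolutely summable real sequences, norm $\|\cdot\|_1$) is identified with the dual of $c_0(\mathbb{N})$ (real null sequences, norm $\|\cdot\|_\infty$) by $\langle\mathbf{v},\mathbf{x}\rangle=\sum_jv_jx_j$. $K:\mathbb{N}\times\mathbb{N}\to\mathbb{R}$ is $K(i,j)=1$ if $i=j$ and $0$ otherwise, so $K(\cdot,j)\in\ell_1(\mathbb{N})$ is the $j$-th unit sequence. For $\mathbf{v}=[v_j:j\in\mathbb{N}]\in c_0(\mathbb{N})$, $\mathbb{N}(\mathbf{v}):=\{j\in\mathbb{N}:|v_j|=\|\mathbf{v}\|_\infty\}$. $\partial\|\cdot\|_\infty(\mathbf{v})\subset\ell_1(\mathbb{N})$ is the subdifferential at $\mathbf{v}$ of the norm of $c_0(\mathbb{N})$, and $\mathrm{ext}$ denotes the set of extreme points. *)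

theory Defs
  imports "HOL-Analysis.Analysis"
begin

typedef c0 = "{v :: nat \<Rightarrow> real. v \<longlonglongrightarrow> 0}"
  morphisms c0_nth Abs_c0
  by (rule exI[of _ "\<lambda>_. 0"]) simp

typedef l1 = "{x :: nat \<Rightarrow> real. summable (\<lambda>i. \<bar>x i\<bar>)}"
  morphisms l1_nth Abs_l1
  by (rule exI[of _ "\<lambda>_. 0"]) simp

setup_lifting type_definition_c0
setup_lifting type_definition_l1

lemma c0_tendsto: "c0_nth v \<longlonglongrightarrow> 0"
  by transfer

lemma l1_summable_abs: "summable (\<lambda>i. \<bar>l1_nth x i\<bar>)"
  by transfer

lemma bdd_above_abs_null_sequence:
  fixes v :: "nat \<Rightarrow> real"
  assumes "v \<longlonglongrightarrow> 0"
  shows "bdd_above (range (\<lambda>i. \<bar>v i\<bar>))"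
proof -
  have "Bseq v"
    using assms by (intro convergent_imp_Bseq convergentI)
  then obtain B where "\<And>i. norm (v i) \<le> B"
    by (auto simp: Bseq_def)
  then show ?thesis
    by (intro bdd_aboveI[of _ B]) auto
qed

instantiation c0 :: real_vector
begin

lift_definition zero_c0 :: c0 is "\<lambda>_. 0" by simp

lift_definition plus_c0 :: "c0 \<Rightarrow> c0 \<Rightarrow> c0" is "\<lambda>v w i. v i + w i"
  by (rule tendsto_add_zero)

lift_definition minus_c0 :: "c0 \<Rightarrow> c0 \<Rightarrow> c0" is "\<lambda>v w i. v i - w i"
  using tendsto_diff by fastforce

lift_definition uminus_c0 :: "c0 \<Rightarrow> c0" is "\<lambda>v i. - v i"
  using tendsto_minus by fastforce

lift_definition scaleR_c0 :: "real \<Rightarrow> c0 \<Rightarrow> c0" is "\<lambda>c v i. c * v i"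
  by (rule tendsto_mult_right_zero)

instance
proof
  fix u v w :: c0 and a b :: real
  show "u + v + w = u + (v + w)" "v + w = w + v" "0 + v = v" "- v + v = 0" "v - w = v + - w"
    by (transfer; simp add: add_ac)+
  show "a *\<^sub>R (v + w) = a *\<^sub>R v + a *\<^sub>R w" "(a + b) *\<^sub>R v = a *\<^sub>R v + b *\<^sub>R v"
    "a *\<^sub>R b *\<^sub>R v = (a * b) *\<^sub>R v" "1 *\<^sub>R v = v"
    by (transfer; simp add: algebra_simps)+
qed

end

instantiation c0 :: real_normed_vector
begin

lift_definition norm_c0 :: "c0 \<Rightarrow> real" is "\<lambda>v. SUP i. \<bar>v i\<bar>" .

definition dist_c0 :: "c0 \<Rightarrow> c0 \<Rightarrow> real"
  where "dist_c0 v w = norm (v - w)"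

definition uniformity_c0 :: "(c0 \<times> c0) filter"
  where "uniformity_c0 = (INF e\<in>{0<..}. principal {(v, w). dist v w < e})"

definition open_c0 :: "c0 set \<Rightarrow> bool"
  where "open_c0 U \<longleftrightarrow> (\<forall>v\<in>U. \<forall>\<^sub>F (v', w) in uniformity. v' = v \<longrightarrow> w \<in> U)"

definition sgn_c0 :: "c0 \<Rightarrow> c0"
  where "sgn_c0 v = v /\<^sub>R norm v"

instance
proof
  fix v w :: c0 and a :: real and U :: "c0 set"
  show "dist v w = norm (v - w)"
    by (rule dist_c0_def)
  show "sgn v = v /\<^sub>R norm v"
    by (rule sgn_c0_def)
  show "uniformity = (INF e\<in>{0<..}. principal {(v :: c0, w). dist v w < e})"
    by (rule uniformity_c0_def)
  show "open U \<longleftrightarrow> (\<forall>v\<in>U. \<forall>\<^sub>F (v', w) in uniformity. v' = v \<longrightarrow> w \<in> U)"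
    by (rule open_c0_def)
  show "norm v = 0 \<longleftrightarrow> v = 0"
  proof transfer
    fix v :: "nat \<Rightarrow> real"
    assume "v \<longlonglongrightarrow> 0"
    then have "\<bar>v i\<bar> \<le> (SUP i. \<bar>v i\<bar>)" for i
      by (intro cSUP_upper bdd_above_abs_null_sequence) auto
    then show "(SUP i. \<bar>v i\<bar>) = 0 \<longleftrightarrow> v = (\<lambda>_. 0)"
      by fastforce
  qed
  show "norm (v + w) \<le> norm v + norm w"
  proof transfer
    fix v w :: "nat \<Rightarrow> real"
    assume "v \<longlonglongrightarrow> 0" "w \<longlonglongrightarrow> 0"
    then have "\<bar>v i\<bar> \<le> (SUP i. \<bar>v i\<bar>)" "\<bar>w i\<bar> \<le> (SUP i. \<bar>w i\<bar>)" for i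
      by (intro cSUP_upper bdd_above_abs_null_sequence; simp)+
    then show "(SUP i. \<bar>v i + w i\<bar>) \<le> (SUP i. \<bar>v i\<bar>) + (SUP i. \<bar>w i\<bar>)"
      by (intro cSUP_least) (auto intro: abs_triangle_ineq[THEN order_trans] add_mono)
  qed
  show "norm (a *\<^sub>R v) = \<bar>a\<bar> * norm v"
  proof transfer
    fix a :: real and v :: "nat \<Rightarrow> real"
    assume v: "v \<longlonglongrightarrow> 0"
    show "(SUP i. \<bar>a * v i\<bar>) = \<bar>a\<bar> * (SUP i. \<bar>v i\<bar>)"
    proof (rule antisym)
      have "\<bar>v i\<bar> \<le> (SUP i. \<bar>v i\<bar>)" for i
        using v by (intro cSUP_upper bdd_above_abs_null_sequence) auto
      then show "(SUP i. \<bar>a * v i\<bar>) \<le> \<bar>a\<bar> * (SUP i. \<bar>v i\<bar>)"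
        by (intro cSUP_least) (auto simp: abs_mult intro: mult_left_mono)
      have le: "\<bar>a * v i\<bar> \<le> (SUP i. \<bar>a * v i\<bar>)" for i
        using tendsto_mult_right_zero[OF v, of a]
        by (intro cSUP_upper bdd_above_abs_null_sequence) auto
      show "\<bar>a\<bar> * (SUP i. \<bar>v i\<bar>) \<le> (SUP i. \<bar>a * v i\<bar>)"
      proof (cases "a = 0")
        case False
        then have "(SUP i. \<bar>v i\<bar>) \<le> (SUP i. \<bar>a * v i\<bar>) / \<bar>a\<bar>"
          using le by (intro cSUP_least) (auto simp: abs_mult pos_le_divide_eq mult.commute)
        with False show ?thesis
          by (simp add: pos_le_divide_eq mult.commute)
      qed simp
    qed
  qed
qed

end

instantiation l1 :: real_vector
begin

lift_definition zero_l1 :: l1 is "\<lambda>_. 0" by simp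

lift_definition plus_l1 :: "l1 \<Rightarrow> l1 \<Rightarrow> l1" is "\<lambda>x y i. x i + y i"
  subgoal for x y
    by (rule summable_comparison_test'[OF summable_add[of "\<lambda>i. \<bar>x i\<bar>" "\<lambda>i. \<bar>y i\<bar>"]]) auto
  done

lift_definition minus_l1 :: "l1 \<Rightarrow> l1 \<Rightarrow> l1" is "\<lambda>x y i. x i - y i"
  subgoal for x y
    by (rule summable_comparison_test'[OF summable_add[of "\<lambda>i. \<bar>x i\<bar>" "\<lambda>i. \<bar>y i\<bar>"]]) auto
  done

lift_definition uminus_l1 :: "l1 \<Rightarrow> l1" is "\<lambda>x i. - x i" by simp

lift_definition scaleR_l1 :: "real \<Rightarrow> l1 \<Rightarrow> l1" is "\<lambda>c x i. c * x i"
  by (simp add: abs_mult summable_mult)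

instance
proof
  fix x y z :: l1 and a b :: real
  show "x + y + z = x + (y + z)" "x + y = y + x" "0 + x = x" "- x + x = 0" "x - y = x + - y"
    by (transfer; simp add: add_ac)+
  show "a *\<^sub>R (x + y) = a *\<^sub>R x + a *\<^sub>R y" "(a + b) *\<^sub>R x = a *\<^sub>R x + b *\<^sub>R x"
    "a *\<^sub>R b *\<^sub>R x = (a * b) *\<^sub>R x" "1 *\<^sub>R x = x"
    by (transfer; simp add: algebra_simps)+
qed

end

instantiation l1 :: real_normed_vector
begin

lift_definition norm_l1 :: "l1 \<Rightarrow> real" is "\<lambda>x. \<Sum>i. \<bar>x i\<bar>" .

definition dist_l1 :: "l1 \<Rightarrow> l1 \<Rightarrow> real"
  where "dist_l1 x y = norm (x - y)"

definition uniformity_l1 :: "(l1 \<times> l1) filter"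
  where "uniformity_l1 = (INF e\<in>{0<..}. principal {(x, y). dist x y < e})"

definition open_l1 :: "l1 set \<Rightarrow> bool"
  where "open_l1 U \<longleftrightarrow> (\<forall>x\<in>U. \<forall>\<^sub>F (x', y) in uniformity. x' = x \<longrightarrow> y \<in> U)"

definition sgn_l1 :: "l1 \<Rightarrow> l1"
  where "sgn_l1 x = x /\<^sub>R norm x"

instance
proof
  fix x y :: l1 and a :: real and U :: "l1 set"
  show "dist x y = norm (x - y)"
    by (rule dist_l1_def)
  show "sgn x = x /\<^sub>R norm x"
    by (rule sgn_l1_def)
  show "uniformity = (INF e\<in>{0<..}. principal {(x :: l1, y). dist x y < e})"
    by (rule uniformity_l1_def)
  show "open U \<longleftrightarrow> (\<forall>x\<in>U. \<forall>\<^sub>F (x', y) in uniformity. x' = x \<longrightarrow> y \<in> U)"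
    by (rule open_l1_def)
  show "norm x = 0 \<longleftrightarrow> x = 0"
    by transfer (auto simp: suminf_eq_zero_iff)
  show "norm (x + y) \<le> norm x + norm y"
  proof transfer
    fix x y :: "nat \<Rightarrow> real"
    assume x: "summable (\<lambda>i. \<bar>x i\<bar>)" and y: "summable (\<lambda>i. \<bar>y i\<bar>)"
    have "summable (\<lambda>i. \<bar>x i + y i\<bar>)"
      by (rule summable_comparison_test'[OF summable_add[OF x y]]) auto
    then have "(\<Sum>i. \<bar>x i + y i\<bar>) \<le> (\<Sum>i. \<bar>x i\<bar> + \<bar>y i\<bar>)"
      by (intro suminf_le summable_add x y) auto
    also have "\<dots> = (\<Sum>i. \<bar>x i\<bar>) + (\<Sum>i. \<bar>y i\<bar>)"
      by (rule suminf_add[OF x y, symmetric])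
    finally show "(\<Sum>i. \<bar>x i + y i\<bar>) \<le> (\<Sum>i. \<bar>x i\<bar>) + (\<Sum>i. \<bar>y i\<bar>)" .
  qed
  show "norm (a *\<^sub>R x) = \<bar>a\<bar> * norm x"
    by transfer (simp add: abs_mult suminf_mult)
qed

end

text \<open>Every continuous linear functional on $c_0$ is \<open>pairing x\<close> for a unique \<open>x :: l1\<close>,
  so subgradients of functions on $c_0$ are taken to be elements of \<open>l1\<close>.\<close>

definition pairing :: "l1 \<Rightarrow> c0 \<Rightarrow> real"
  where "pairing x v = (\<Sum>j. l1_nth x j * c0_nth v j)"

lemma summable_pairing: "summable (\<lambda>j. l1_nth x j * c0_nth v j)"
proof -
  have "Bseq (c0_nth v)"
    using c0_tendsto by (intro convergent_imp_Bseq convergentI)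
  then obtain B where B: "\<And>j. norm (c0_nth v j) \<le> B"
    by (auto simp: Bseq_def)
  show ?thesis
    by (rule summable_comparison_test'[OF summable_mult2[OF l1_summable_abs, of _ B]])
      (use B in \<open>auto simp: abs_mult intro: mult_left_mono\<close>)
qed

definition subdifferential :: "(c0 \<Rightarrow> real) \<Rightarrow> c0 \<Rightarrow> l1 set"
  where "subdifferential \<phi> v = {x. \<forall>w. \<phi> w - \<phi> v \<ge> pairing x (w - v)}"

definition ext :: "'a :: real_vector set \<Rightarrow> 'a set"
  where "ext S = {x. x extreme_point_of S}"

definition K :: "nat \<Rightarrow> nat \<Rightarrow> real"
  where "K i j = (if i = j then 1 else 0)"

lift_definition K_col :: "nat \<Rightarrow> l1" is "\<lambda>j i. K i j"
proof -
  fix j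
  show "summable (\<lambda>i. \<bar>K i j\<bar>)"
    by (rule summable_finite[of "{j}"]) (auto simp: K_def)
qed

definition max_indices :: "c0 \<Rightarrow> nat set"
  where "max_indices v = {j. \<bar>c0_nth v j\<bar> = norm v}"

end

theory Submission
  imports Defs
begin

text \<open>
  For \<open>u \<noteq> 0\<close> the subdifferential of the norm at \<open>u\<close> is the face of the dual unit ball on which
  \<open>u\<close> attains its norm: it consists of the \<open>x\<close> with \<open>\<parallel>x\<parallel>\<^sub>1 \<le> 1\<close> and \<open>\<langle>u, x\<rangle> = \<parallel>u\<parallel>\<close>
  (\<open>subdifferential_norm_iff\<close>).  For such an \<open>x\<close> the estimate
  \<open>\<Sum>j x\<^sub>j u\<^sub>j \<le> \<Sum>j \<bar>x\<^sub>j\<bar> \<parallel>u\<parallel> \<le> \<parallel>u\<parallel>\<close> is an equality, so it is an equality in every term: \<open>x\<close> has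
  norm \<open>1\<close>, it lives on the indices where \<open>\<bar>u\<^sub>j\<bar>\<close> is maximal, and it has the sign of \<open>u\<close> there
  (\<open>subgradient_coordinate\<close>, \<open>norm_subgradient\<close>).

  Let \<open>x\<^sub>i \<noteq> 0\<close>.  Unless \<open>x\<close> is already \<open>\<plusminus>K(\<cdot>,i)\<close>, it has mass off \<open>i\<close>, and it is a proper convex
  combination of \<open>sgn x\<^sub>i K(\<cdot>,i)\<close> and its renormalised restriction to the other coordinates.  Both
  lie in the face, because the \<open>\<ell>\<^sub>1\<close> norm and the pairing split over disjoint coordinates.  Hence
  the extreme points are signed unit sequences at maximal indices.  There are finitely many
  such indices because \<open>u\<close> tends to \<open>0\<close> and \<open>\<parallel>u\<parallel> > 0\<close>.
  The second claim is again that the \<open>\<ell>\<^sub>1\<close> norm splits over disjoint coordinates.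
\<close>

section \<open>The pairing\<close>

lemma abs_c0_nth_le_norm: "\<bar>c0_nth v i\<bar> \<le> norm v"
  by transfer (auto intro: cSUP_upper bdd_above_abs_null_sequence)

lemma norm_c0_le: "(\<And>i. \<bar>c0_nth v i\<bar> \<le> B) \<Longrightarrow> norm v \<le> B"
  by transfer (auto intro: cSUP_least)

lemma sums_norm_l1: "(\<lambda>i. \<bar>l1_nth x i\<bar>) sums norm x"
  by transfer (rule summable_sums)

lemma sums_pairing: "(\<lambda>j. l1_nth x j * c0_nth v j) sums pairing x v"
  unfolding pairing_def by (rule summable_sums[OF summable_pairing])

lemma abs_pairing_term_le: "\<bar>l1_nth x j * c0_nth v j\<bar> \<le> \<bar>l1_nth x j\<bar> * norm v"
  by (simp add: abs_mult abs_c0_nth_le_norm mult_left_mono)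

lemma abs_pairing_le: "\<bar>pairing x v\<bar> \<le> norm x * norm v"
proof -
  have s: "(\<lambda>j. \<bar>l1_nth x j\<bar> * norm v) sums (norm x * norm v)"
    by (rule sums_mult2[OF sums_norm_l1])
  have "pairing x v \<le> norm x * norm v"
    using abs_pairing_term_le[THEN abs_le_D1] by (rule sums_le[OF _ sums_pairing s])
  moreover have "- pairing x v \<le> norm x * norm v"
    using abs_pairing_term_le[THEN abs_le_D2] by (rule sums_le[OF _ sums_minus[OF sums_pairing] s])
  ultimately show ?thesis by simp
qed

lemma bounded_bilinear_pairing: "bounded_bilinear pairing"
proof
  fix x y :: l1 and v w :: c0 and r :: real
  show "pairing (x + y) v = pairing x v + pairing y v"
    using sums_add[OF sums_pairing sums_pairing, of x v y v]
    by (intro sums_unique2[OF sums_pairing]) (simp add: plus_l1.rep_eq algebra_simps)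
  show "pairing x (v + w) = pairing x v + pairing x w"
    using sums_add[OF sums_pairing sums_pairing, of x v x w]
    by (intro sums_unique2[OF sums_pairing]) (simp add: plus_c0.rep_eq algebra_simps)
  show "pairing (r *\<^sub>R x) v = r *\<^sub>R pairing x v"
    using sums_mult[OF sums_pairing, of r x v]
    by (intro sums_unique2[OF sums_pairing]) (simp add: scaleR_l1.rep_eq algebra_simps)
  show "pairing x (r *\<^sub>R v) = r *\<^sub>R pairing x v"
    using sums_mult[OF sums_pairing, of r x v]
    by (intro sums_unique2[OF sums_pairing]) (simp add: scaleR_c0.rep_eq algebra_simps)
next
  have "norm (pairing x v) \<le> norm x * norm v * 1" for x v
    using abs_pairing_le[of x v] by simp
  then show "\<exists>B. \<forall>x v. norm (pairing x v) \<le> norm x * norm v * B"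
    by blast
qed

interpretation pairing: bounded_bilinear pairing
  by (rule bounded_bilinear_pairing)

text \<open>The sign sequence of \<open>x\<close> need not be null, so its finite truncations serve as test
  elements; they recover the partial sums of the \<open>\<ell>\<^sub>1\<close> norm.\<close>

lemma norm_l1_le_if_pairing_le:
  assumes "\<And>w. pairing x w \<le> norm w"
  shows "norm x \<le> 1"
proof -
  have "(\<Sum>i<N. \<bar>l1_nth x i\<bar>) \<le> 1" for N
  proof -
    define w where "w = Abs_c0 (\<lambda>i. if i < N then sgn (l1_nth x i) else 0)"
    have "(\<lambda>i. if i < N then sgn (l1_nth x i) else 0) \<longlonglongrightarrow> 0"
      by (rule tendsto_eventually) (auto simp: eventually_sequentially intro!: exI[of _ N])
    then have w: "c0_nth w i = (if i < N then sgn (l1_nth x i) else 0)" for i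
      by (simp add: w_def Abs_c0_inverse)
    have "(\<Sum>i<N. \<bar>l1_nth x i\<bar>) = (\<Sum>i<N. l1_nth x i * c0_nth w i)"
      by (simp add: w abs_sgn)
    also have "\<dots> = pairing x w"
      unfolding pairing_def by (rule suminf_finite[symmetric]) (auto simp: w)
    also have "\<dots> \<le> norm w"
      by (rule assms)
    also have "\<dots> \<le> 1"
      by (rule norm_c0_le) (auto simp: w sgn_if)
    finally show ?thesis .
  qed
  then have "(\<Sum>i. \<bar>l1_nth x i\<bar>) \<le> 1"
    by (intro suminf_le_const l1_summable_abs)
  then show ?thesis
    by (simp add: norm_l1.rep_eq)
qed

section \<open>Unit sequences\<close>

lemma l1_nth_K_col: "l1_nth (K_col j) i = (if i = j then 1 else 0)"
  by transfer (simp add: K_def)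

lemma pairing_K_col: "pairing (K_col j) v = c0_nth v j"
  unfolding pairing_def by (subst suminf_finite[of "{j}"]) (auto simp: l1_nth_K_col)

lemma l1_nth_sum: "l1_nth (sum f A) i = (\<Sum>a\<in>A. l1_nth (f a) i)"
  by (induction A rule: infinite_finite_induct) (auto simp: zero_l1.rep_eq plus_l1.rep_eq)

lemma norm_l1_remove_coordinate:
  "norm (x - l1_nth x i *\<^sub>R K_col i) = norm x - \<bar>l1_nth x i\<bar>"
proof (rule sums_unique2[OF sums_norm_l1])
  have "(\<lambda>j. \<bar>l1_nth x j\<bar> - (if j = i then \<bar>l1_nth x j\<bar> else 0)) sums (norm x - \<bar>l1_nth x i\<bar>)"
    by (intro sums_diff sums_norm_l1 sums_single)
  also have "(\<lambda>j. \<bar>l1_nth x j\<bar> - (if j = i then \<bar>l1_nth x j\<bar> else 0))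
      = (\<lambda>j. \<bar>l1_nth (x - l1_nth x i *\<^sub>R K_col i) j\<bar>)"
    by (auto simp: minus_l1.rep_eq scaleR_l1.rep_eq l1_nth_K_col)
  finally show "(\<lambda>j. \<bar>l1_nth (x - l1_nth x i *\<^sub>R K_col i) j\<bar>) sums (norm x - \<bar>l1_nth x i\<bar>)" .
qed

lemma norm_sum_K_col:
  assumes "finite A" "inj_on l A"
  shows "norm (\<Sum>a\<in>A. \<alpha> a *\<^sub>R K_col (l a)) = (\<Sum>a\<in>A. \<bar>\<alpha> a\<bar>)"
  using assms
proof (induction A rule: finite_induct)
  case (insert b A)
  define x where "x = (\<Sum>a\<in>insert b A. \<alpha> a *\<^sub>R K_col (l a))"
  have "l b \<noteq> l a" if "a \<in> A" for a
    using insert.prems insert.hyps(2) that by auto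
  then have "l1_nth x (l b) = \<alpha> b"
    using insert.hyps
    by (auto simp: x_def l1_nth_sum plus_l1.rep_eq scaleR_l1.rep_eq l1_nth_K_col intro!: sum.neutral)
  then show ?case
    using norm_l1_remove_coordinate[of x "l b"] insert by (simp add: x_def)
qed simp

lemma norm_K_col [simp]: "norm (K_col j) = 1"
  using norm_sum_K_col[of "{j}" id "\<lambda>_. 1"] by simp

section \<open>Subgradients of the supremum norm\<close>

text \<open>Positive homogeneity of the norm turns the subgradient inequality, tested at \<open>0\<close> and \<open>2u\<close>,
  into \<open>\<langle>u, x\<rangle> = \<parallel>u\<parallel>\<close>; what remains of it is then the dual norm bound.\<close>

lemma subdifferential_norm_iff:
  "x \<in> subdifferential norm u \<longleftrightarrow> norm x \<le> 1 \<and> pairing x u = norm u"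
proof
  assume "x \<in> subdifferential norm u"
  then have sub: "pairing x w - pairing x u \<le> norm w - norm u" for w
    by (simp add: subdifferential_def pairing.diff_right)
  have eq: "pairing x u = norm u"
    using sub[of 0] sub[of "2 *\<^sub>R u"] by (simp add: pairing.zero_right pairing.scaleR_right)
  have "norm x \<le> 1"
    by (rule norm_l1_le_if_pairing_le) (use sub eq in simp)
  with eq show "norm x \<le> 1 \<and> pairing x u = norm u"
    by simp
next
  assume x: "norm x \<le> 1 \<and> pairing x u = norm u"
  have "pairing x w \<le> norm w" for w
    using abs_pairing_le[of x w] mult_right_mono[of "norm x" 1 "norm w"] x by simp
  with x show "x \<in> subdifferential norm u"
    by (simp add: subdifferential_def pairing.diff_right)
qed

text \<open>The terms \<open>\<bar>x\<^sub>j\<bar> \<parallel>u\<parallel> - x\<^sub>j u\<^sub>j\<close> are nonnegative and their sum is \<open>\<parallel>x\<parallel>\<^sub>1 \<parallel>u\<parallel> - \<langle>u, x\<rangle> \<le> 0\<close>,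
  so each of them vanishes.\<close>

lemma subgradient_coordinate:
  assumes "x \<in> subdifferential norm u"
  shows "l1_nth x j * c0_nth u j = \<bar>l1_nth x j\<bar> * norm u"
proof -
  define d where "d j = \<bar>l1_nth x j\<bar> * norm u - l1_nth x j * c0_nth u j" for j
  have d: "d sums (norm x * norm u - pairing x u)"
    unfolding d_def by (intro sums_diff sums_mult2 sums_norm_l1 sums_pairing)
  have nonneg: "d j \<ge> 0" for j
    using abs_pairing_term_le[of x j u] by (simp add: d_def)
  have "norm x * norm u - pairing x u \<le> 0"
    using assms mult_right_mono[of "norm x" 1 "norm u"] by (simp add: subdifferential_norm_iff)
  then have "suminf d = 0"
    using suminf_nonneg[OF sums_summable[OF d] nonneg] sums_unique[OF d] by simp
  then have "d j = 0"
    using suminf_eq_zero_iff[OF sums_summable[OF d] nonneg] by simp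
  then show ?thesis
    by (simp add: d_def)
qed

lemma norm_subgradient:
  assumes "u \<noteq> 0" "x \<in> subdifferential norm u"
  shows "norm x = 1"
proof (rule antisym)
  have "1 * norm u \<le> norm x * norm u"
    using assms abs_pairing_le[of x u] by (simp add: subdifferential_norm_iff)
  then show "1 \<le> norm x"
    using assms(1) by simp
qed (use assms in \<open>simp add: subdifferential_norm_iff\<close>)

lemma finite_max_indices:
  assumes "u \<noteq> 0"
  shows "finite (max_indices u)"
proof -
  have "\<forall>\<^sub>F j in sequentially. \<bar>c0_nth u j\<bar> < norm u"
    using tendsto_rabs_zero[OF c0_tendsto, of u] assms by (intro order_tendstoD) auto
  then obtain N where "\<And>j. j \<ge> N \<Longrightarrow> \<bar>c0_nth u j\<bar> < norm u"
    by (auto simp: eventually_sequentially)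
  then have "max_indices u \<subseteq> {..<N}"
    by (force simp: max_indices_def not_less[symmetric])
  then show ?thesis
    by (rule finite_subset) simp
qed

text \<open>For \<open>u \<noteq> 0\<close>, a subgradient other than \<open>\<plusminus>K(\<cdot>,i)\<close> with \<open>x\<^sub>i \<noteq> 0\<close> has \<open>0 < \<bar>x\<^sub>i\<bar> < 1\<close>, so splitting off the
  \<open>i\<close>-th coordinate exhibits it as an interior point of a segment in the subdifferential.\<close>

lemma extreme_subgradient_is_unit:
  assumes "u \<noteq> 0" and ext: "x extreme_point_of subdifferential norm u"
  obtains i where "i \<in> max_indices u" "x = - K_col i \<or> x = K_col i"
proof -
  have x: "x \<in> subdifferential norm u"
    using ext by (simp add: extreme_point_of_def)
  have norm_x: "norm x = 1" and pair_x: "pairing x u = norm u"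
    using norm_subgradient[OF assms(1) x] x by (auto simp: subdifferential_norm_iff)
  have "\<exists>i. l1_nth x i \<noteq> 0"
    using norm_x by (rule contrapos_pp) (simp add: norm_l1.rep_eq)
  then obtain i where i: "l1_nth x i \<noteq> 0" ..
  define s t where "s = sgn (l1_nth x i)" and "t = \<bar>l1_nth x i\<bar>"
  define z where "z = x - l1_nth x i *\<^sub>R K_col i"
  have st: "l1_nth x i = t * s" and t: "t > 0" and s: "s = 1 \<or> s = -1"
    using i by (auto simp: s_def t_def sgn_if)
  have coord: "s * c0_nth u i = norm u"
    using subgradient_coordinate[OF x, of i, folded t_def, unfolded st] t by simp
  then have "i \<in> max_indices u"
    using s abs_c0_nth_le_norm[of u i] by (auto simp: max_indices_def)
  moreover have norm_z: "norm z = 1 - t"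
    using norm_l1_remove_coordinate[of x i] by (simp add: norm_x z_def t_def)
  have "t = 1"
  proof (rule ccontr)
    assume "t \<noteq> 1"
    with norm_z norm_ge_zero[of z] have "t < 1"
      by linarith
    define y where "y = (1 / (1 - t)) *\<^sub>R z"
    have "s *\<^sub>R K_col i \<in> subdifferential norm u"
      using s coord by (auto simp: subdifferential_norm_iff pairing.scaleR_left pairing_K_col)
    moreover have "y \<in> subdifferential norm u"
    proof -
      have "pairing z u = (1 - t) * norm u"
        using coord
        by (simp add: z_def st pairing.diff_left pairing.scaleR_left pairing_K_col pair_x
            algebra_simps)
      then show ?thesis
        using \<open>t < 1\<close> by (simp add: y_def subdifferential_norm_iff pairing.scaleR_left norm_z)
    qed
    moreover have "x \<in> open_segment y (s *\<^sub>R K_col i)"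
    proof -
      \<comment> \<open>The end points differ at the coordinate \<open>i\<close>, which is \<open>0\<close> for \<open>y\<close>.\<close>
      have "l1_nth y i = 0" "l1_nth (s *\<^sub>R K_col i) i = s"
        by (simp_all add: y_def z_def scaleR_l1.rep_eq minus_l1.rep_eq l1_nth_K_col)
      then have "y \<noteq> s *\<^sub>R K_col i"
        using s by auto
      moreover have "x = (1 - t) *\<^sub>R y + t *\<^sub>R s *\<^sub>R K_col i"
        using \<open>t < 1\<close> by (simp add: y_def z_def st)
      ultimately show ?thesis
        using t \<open>t < 1\<close> by (auto simp: in_segment)
    qed
    ultimately show False
      using ext by (auto simp: extreme_point_of_def)
  qed
  then have "z = 0" using norm_z by simp
  then have "x = s *\<^sub>R K_col i"
    by (simp add: z_def st \<open>t = 1\<close>)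
  ultimately show ?thesis
    using that s by auto
qed

theorem lemma16:
  fixes n :: nat and v :: "nat \<Rightarrow> c0" and V :: "c0 set"
  assumes lin_indep: "inj_on v {1..n}" "independent (v ` {1..n})"
    and V: "V = span (v ` {1..n})"
  shows "(\<forall>u\<in>V. u \<noteq> 0 \<longrightarrow>
            finite (max_indices u) \<and>
            ext (subdifferential norm u)
              \<subseteq> (\<Union>j\<in>max_indices u. {- K_col j, K_col j})) \<and>
         (\<forall>(m::nat) (l :: nat \<Rightarrow> nat) (\<alpha> :: nat \<Rightarrow> real).
            inj_on l {1..m} \<longrightarrow>
            norm (\<Sum>j=1..m. \<alpha> j *\<^sub>R K_col (l j)) = (\<Sum>j=1..m. \<bar>\<alpha> j\<bar>))"
proof (intro conjI ballI allI impI subsetI)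
  fix u :: c0
  assume "u \<noteq> 0"
  then show "finite (max_indices u)"
    by (rule finite_max_indices)
  fix x
  assume "x \<in> ext (subdifferential norm u)"
  with \<open>u \<noteq> 0\<close> show "x \<in> (\<Union>j\<in>max_indices u. {- K_col j, K_col j})"
    by (auto simp: ext_def elim!: extreme_subgradient_is_unit)
next
  fix m :: nat and l :: "nat \<Rightarrow> nat" and \<alpha> :: "nat \<Rightarrow> real"
  assume "inj_on l {1..m}"
  then show "norm (\<Sum>j=1..m. \<alpha> j *\<^sub>R K_col (l j)) = (\<Sum>j=1..m. \<bar>\<alpha> j\<bar>)"
    by (intro norm_sum_K_col) auto
qed

end
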